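(* Let $(X_n)_{n\in\mathbb{Z}_+}$ be a Markov chain in a countable state space $E\cup\{\partial\}$, with $\partial\notin E$ an absorbing point, whose transition probabilities are irreducible and aperiodic in $E$ and whose absorption time $\tau_\partial$ is almost surely finite, and let $R\in[1,\infty)$ be defined by $\frac1R=\lim_{n\to+\infty}\mathbb{P}_x(X_n=y)^{1/n}$. Assume that there exist a non-empty set $K\subset E$ and $x_0\in K$ such that: (a) there exist $\varepsilon_0>0$ and a constant $C_1$ such that, for all $x\in K$ and all $n\ge0$, $\mathbb{P}_x(n<\sigma_K\wedge\tau_\partial)\le C_1(R+\varepsilon_0)^{-n}$; (b) there exists a constant $C_2$ such that, for all $x\in K$ and $n\ge0$, $\mathbb{P}_x(n<\tau_\partial)\le C_2\,\mathbb{P}_{x_0}(n<\tau_\partial)$; (c) there exist $n_0\ge0$ and a constant $C_3>0$ such that, for all $x\in K$, $\mathbb{P}_x(T_{\{x_0\}}\le n_0)\ge C_3$. Then Assumption (E) (defined in the context) is satisfied.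
   Context: $\mathbb{P}_x$ is the law of the chain started from $x$; $\tau_\partial=\inf\{n\in\mathbb{Z}_+:X_n=\partial\}$; $\sigma_K=\inf\{n\ge1:X_n\in K\}$ is the first return time to $K$; $T_A=\inf\{n\in\mathbb{Z}_+:X_n\in A\}$. Irreducible in $E$: for all $x,y\in E$ there is $n\ge1$ with $\mathbb{P}_x(X_n=y)>0$. Aperiodic: for all $x,y\in E$, $\mathbb{P}_x(X_n=y)>0$ for all $n$ large enough. Under these conditions the limit defining $1/R$ exists and does not depend on $x,y\in E$. $P_1f(x)=\mathbb{E}_x(f(X_1)\mathbf{1}_{1<\tau_\partial})$. Assumption (E). There exist a positive integer $n_1$, positive real constants $\theta_1,\theta_2,c_1,c_2,c_3$, two functions $\varphi_1,\varphi_2:E\to\mathbb{R}_+$ and a probability measure $\nu$ on a subset $K\subset E$ such that: - (E1) for all $x\in K$, $\mathbb{P}_x(X_{n_1}\in\cdot)\ge c_1\nu(\cdot\cap K)$. - (E2) $\theta_1<\theta_2$, $\inf_E\varphi_1\ge1$, $\sup_K\varphi_1<\infty$, $\inf_K\varphi_2>0$, $\sup_E\varphi_2\le1$, and for all $x\in E$, $P_1\varphi_1(x)\le\theta_1\varphi_1(x)+c_2\mathbf{1}_K(x)$ and $P_1\varphi_2(x)\ge\theta_2\varphi_2(x)$. - (E3) $\displaystyle\sup_{n\in\mathbb{Z}_+}\frac{\sup_{y\in K}\mathbb{P}_y(n<\tau_\partial)}{\inf_{y\in K}\mathbb{P}_y(n<\tau_\partial)}\le c_3$. - (E4) for all $x\in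 K$ there exists $n_4(x)$ such that $\mathbb{P}_x(X_n\in K)>0$ for all $n\ge n_4(x)$. *)

theory Defs
  imports "HOL-Probability.Probability"
begin

text \<open>
  Hitting and return times take values in \<^typ>\<open>enat\<close>, where the infimum of the empty set
  is \<open>\<infinity>\<close>.
\<close>

definition hitting_time :: "(nat \<Rightarrow> 'w \<Rightarrow> 's) \<Rightarrow> 's set \<Rightarrow> 'w \<Rightarrow> enat" where
  "hitting_time X A \<omega> = Inf {enat n |n. X n \<omega> \<in> A}"

definition return_time :: "(nat \<Rightarrow> 'w \<Rightarrow> 's) \<Rightarrow> 's set \<Rightarrow> 'w \<Rightarrow> enat" where
  "return_time X A \<omega> = Inf {enat n |n. 1 \<le> n \<and> X n \<omega> \<in> A}"

definition absorption_time :: "(nat \<Rightarrow> 'w \<Rightarrow> 's) \<Rightarrow> 's \<Rightarrow> 'w \<Rightarrow> enat" where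
  "absorption_time X cem \<omega> = Inf {enat n |n. X n \<omega> = cem}"

text \<open>
  A time-homogeneous Markov chain \<open>X\<close> on the countable state space \<open>E \<union> {cem}\<close>, where \<open>cem\<close> is
  the absorbing point: \<open>P x\<close> is the law, on the common measurable space \<open>M\<close>, of the chain
  started from \<open>x\<close>, and the transition probability from \<open>x\<close> to \<open>y\<close> is \<open>\<P>(\<omega> in P x. X 1 \<omega> = y)\<close>.
  The Markov property is stated without conditional probabilities, so that histories of
  probability zero need no special treatment.
\<close>

locale absorbed_markov_chain =
  fixes E :: "'s set" and cem :: 's
    and M :: "'w measure" and P :: "'s \<Rightarrow> 'w measure" and X :: "nat \<Rightarrow> 'w \<Rightarrow> 's"
  assumes countable_E: "countable E"
    and cem_notin_E: "cem \<notin> E"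
    and measurable_X: "\<And>n. X n \<in> measurable M (count_space (insert cem E))"
    and prob_space_P: "\<And>x. x \<in> insert cem E \<Longrightarrow> prob_space (P x)"
    and sets_P: "\<And>x. x \<in> insert cem E \<Longrightarrow> sets (P x) = sets M"
    and start: "\<And>x. x \<in> insert cem E \<Longrightarrow> \<P>(\<omega> in P x. X 0 \<omega> = x) = 1"
    and markov: "\<And>x n z. x \<in> insert cem E \<Longrightarrow> (\<forall>i\<le>Suc n. z i \<in> insert cem E) \<Longrightarrow>
        \<P>(\<omega> in P x. \<forall>i\<le>Suc n. X i \<omega> = z i) =
        \<P>(\<omega> in P x. \<forall>i\<le>n. X i \<omega> = z i) * \<P>(\<omega> in P (z n). X 1 \<omega> = z (Suc n))"
    and absorbing: "\<P>(\<omega> in P cem. X 1 \<omega> = cem) = 1"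

definition irreducible_in :: "'s set \<Rightarrow> ('s \<Rightarrow> 'w measure) \<Rightarrow> (nat \<Rightarrow> 'w \<Rightarrow> 's) \<Rightarrow> bool" where
  "irreducible_in E P X \<longleftrightarrow> (\<forall>x\<in>E. \<forall>y\<in>E. \<exists>n\<ge>1. \<P>(\<omega> in P x. X n \<omega> = y) > 0)"

definition aperiodic_in :: "'s set \<Rightarrow> ('s \<Rightarrow> 'w measure) \<Rightarrow> (nat \<Rightarrow> 'w \<Rightarrow> 's) \<Rightarrow> bool" where
  "aperiodic_in E P X \<longleftrightarrow>
     (\<forall>x\<in>E. \<forall>y\<in>E. \<exists>N. \<forall>n\<ge>N. \<P>(\<omega> in P x. X n \<omega> = y) > 0)"

text \<open>
  The operator \<open>P\<^sub>1\<close>, only meant for \<open>f\<close> nonnegative on \<open>E\<close>. It is \<^typ>\<open>ennreal\<close>-valued because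
  the expectation may be infinite.
\<close>

definition P1_op ::
    "'s \<Rightarrow> ('s \<Rightarrow> 'w measure) \<Rightarrow> (nat \<Rightarrow> 'w \<Rightarrow> 's) \<Rightarrow> ('s \<Rightarrow> real) \<Rightarrow> 's \<Rightarrow> ennreal" where
  "P1_op cem P X f x =
     (\<integral>\<^sup>+ \<omega>. ennreal (f (X 1 \<omega>)) * indicator {\<omega>. 1 < absorption_time X cem \<omega>} \<omega> \<partial>P x)"

text \<open>
  Suprema and infima are taken in \<^typ>\<open>ereal\<close> or \<^typ>\<open>ennreal\<close>, so that they are always
  meaningful. In (E3), division in \<^typ>\<open>ennreal\<close> satisfies \<open>a / 0 = \<infinity>\<close> for \<open>a \<noteq> 0\<close>, so the
  bound forces the infimum to be positive whenever the supremum is.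
\<close>

definition assumption_E ::
    "'s set \<Rightarrow> 's \<Rightarrow> ('s \<Rightarrow> 'w measure) \<Rightarrow> (nat \<Rightarrow> 'w \<Rightarrow> 's) \<Rightarrow> bool" where
  "assumption_E E cem P X \<longleftrightarrow>
    (\<exists>(n\<^sub>1::nat) (\<theta>\<^sub>1::real) (\<theta>\<^sub>2::real) (c\<^sub>1::real) (c\<^sub>2::real) (c\<^sub>3::real)
       (\<phi>\<^sub>1::'s \<Rightarrow> real) (\<phi>\<^sub>2::'s \<Rightarrow> real) (K::'s set) (\<nu>::'s measure).
      n\<^sub>1 > 0 \<and> \<theta>\<^sub>1 > 0 \<and> \<theta>\<^sub>2 > 0 \<and> c\<^sub>1 > 0 \<and> c\<^sub>2 > 0 \<and> c\<^sub>3 > 0 \<and>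
      (\<forall>x\<in>E. \<phi>\<^sub>1 x \<ge> 0) \<and> (\<forall>x\<in>E. \<phi>\<^sub>2 x \<ge> 0) \<and>
      K \<subseteq> E \<and> prob_space \<nu> \<and> sets \<nu> = sets (count_space K) \<and>
      \<comment> \<open>(E1)\<close>
      (\<forall>x\<in>K. \<forall>A\<subseteq>E. \<P>(\<omega> in P x. X n\<^sub>1 \<omega> \<in> A) \<ge> c\<^sub>1 * measure \<nu> (A \<inter> K)) \<and>
      \<comment> \<open>(E2)\<close>
      \<theta>\<^sub>1 < \<theta>\<^sub>2 \<and>
      (INF x\<in>E. ereal (\<phi>\<^sub>1 x)) \<ge> 1 \<and> (SUP x\<in>K. ereal (\<phi>\<^sub>1 x)) < \<infinity> \<and>
      (INF x\<in>K. ereal (\<phi>\<^sub>2 x)) > 0 \<and> (SUP x\<in>E. ereal (\<phi>\<^sub>2 x)) \<le> 1 \<and>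
      (\<forall>x\<in>E. P1_op cem P X \<phi>\<^sub>1 x \<le> ennreal (\<theta>\<^sub>1 * \<phi>\<^sub>1 x + c\<^sub>2 * indicator K x)) \<and>
      (\<forall>x\<in>E. P1_op cem P X \<phi>\<^sub>2 x \<ge> ennreal (\<theta>\<^sub>2 * \<phi>\<^sub>2 x)) \<and>
      \<comment> \<open>(E3)\<close>
      (SUP n. (SUP y\<in>K. ennreal \<P>(\<omega> in P y. enat n < absorption_time X cem \<omega>)) /
              (INF y\<in>K. ennreal \<P>(\<omega> in P y. enat n < absorption_time X cem \<omega>)))
        \<le> ennreal c\<^sub>3 \<and>
      \<comment> \<open>(E4)\<close>
      (\<forall>x\<in>K. \<exists>n\<^sub>4. \<forall>n\<ge>n\<^sub>4. \<P>(\<omega> in P x. X n \<omega> \<in> K) > 0))"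

end

theory Submission
  imports Defs
begin

text \<open>
  The set \<open>K\<close> of the hypotheses also serves as the set \<open>K\<close> of Assumption (E), and \<open>\<nu>\<close> is the
  Dirac mass at \<open>x\<^sub>0\<close>. Write \<open>p\<^sub>k(x, y)\<close> for the \<open>k\<close>-step transition probabilities.

  Hypothesis (c) makes \<open>x\<^sub>0\<close> uniformly accessible from \<open>K\<close>: if \<open>x\<^sub>0\<close> is visited by time \<open>n\<^sub>0\<close> with
  probability at least \<open>C\<^sub>3\<close>, then by a union bound one of the \<open>n\<^sub>0 + 1\<close> times \<open>k \<le> n\<^sub>0\<close> satisfies
  \<open>p\<^sub>k(x, x\<^sub>0) \<ge> \<delta>\<close> with \<open>\<delta> = C\<^sub>3 / (n\<^sub>0 + 1)\<close> (\<open>hitting_imp_visit\<close>). The time \<open>k\<close> depends on \<open>x\<close>, but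
  only through finitely many values, and this form is enough throughout.
  For (E1), the chain is back at \<open>x\<^sub>0\<close> at a common time \<open>n\<^sub>1\<close>, at a positive cost by aperiodicity
  (\<open>minorization_by_atom\<close>). For (E3), the chain started from \<open>x\<close> survives at least as well as the
  one that goes to \<open>x\<^sub>0\<close> and then survives, so \<open>\<P>\<^sub>x(n < \<tau>) \<ge> \<delta> \<P>\<^sub>x\<^sub>0(n < \<tau>)\<close>
  (\<open>survival_ge_if_visit\<close>), while (b) is the matching upper bound. (E4) is aperiodicity.

  For (E2), choose \<open>1 / (R + \<epsilon>\<^sub>0) < \<theta>\<^sub>1 < \<theta>\<^sub>2 < 1 / R\<close>.
  Let \<open>G(x) = (\<Sum>n. \<theta>\<^sub>1\<^sup>-\<^sup>n \<P>\<^sub>x(X\<^sub>1, \<dots>, X\<^sub>n \<in> E - K))\<close>. By (a) it is bounded on \<open>K\<close>, because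
  \<open>\<theta>\<^sub>1 > 1 / (R + \<epsilon>\<^sub>0)\<close>. One step of the chain gives \<open>G = 1 + \<theta>\<^sub>1\<^sup>-\<^sup>1 P\<^sub>1(G 1\<^bsub>E - K\<^esub>)\<close>. Hence finiteness of \<open>G\<close>
  propagates along transitions, and irreducibility makes \<open>G\<close> finite on \<open>E\<close>. The same identity shows
  that the function \<open>\<phi>\<^sub>1\<close> equal to \<open>1\<close> on \<open>K\<close> and to \<open>G / \<theta>\<^sub>1\<close> elsewhere satisfies \<open>P\<^sub>1\<phi>\<^sub>1 \<le> G\<close>. This is the
  required drift, as \<open>G\<close> is \<open>\<theta>\<^sub>1\<phi>\<^sub>1\<close> off \<open>K\<close> and bounded on \<open>K\<close> (\<open>upper_drift_function\<close>).

  As \<open>p\<^sub>l(x\<^sub>0, x\<^sub>0)\<^bsup>1/l\<^esup>\<close> tends to \<open>1 / R > \<theta>\<^sub>2\<close>, there is \<open>l > n\<^sub>0\<close> with \<open>p\<^sub>l(x\<^sub>0, x\<^sub>0) \<ge> \<theta>\<^sub>2\<^sup>l\<close>. Then \<open>\<phi>\<^sub>2\<close> is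
  the normalisation of \<open>\<Sum>k<l. \<theta>\<^sub>2\<^sup>-\<^sup>k p\<^sub>k(\<cdot>, x\<^sub>0)\<close>: applying \<open>P\<^sub>1\<close> shifts the sum, and the
  boundary terms have the right sign (\<open>lower_drift_function\<close>). Uniform accessibility of \<open>x\<^sub>0\<close> bounds
  \<open>\<phi>\<^sub>2\<close> below on \<open>K\<close>.

  The hypotheses describe the chain through probabilities of finite paths, whereas these arguments need
  one-step and several-step decompositions. The bridge is \<open>measure_traj\<close>: the law of
  \<open>(X\<^sub>0, \<dots>, X\<^sub>n)\<close> is the one obtained by iterating a transition kernel of type \<open>'s pmf\<close>, for which
  such decompositions are laws of the monadic bind.
\<close>

section \<open>Trajectories of a discrete transition kernel\<close>

primrec kpow :: "('s \<Rightarrow> 's pmf) \<Rightarrow> nat \<Rightarrow> 's \<Rightarrow> 's pmf" where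
  "kpow \<kappa> 0 x = return_pmf x"
| "kpow \<kappa> (Suc n) x = bind_pmf (\<kappa> x) (kpow \<kappa> n)"

text \<open>
  The law of \<open>[X\<^sub>0, \<dots>, X\<^sub>n]\<close> for the chain with kernel \<open>\<kappa>\<close> started from \<open>x\<close>. The recursion is
  on the first step, as for \<open>kpow\<close> and \<open>stay\<close>.
\<close>

primrec traj :: "('s \<Rightarrow> 's pmf) \<Rightarrow> nat \<Rightarrow> 's \<Rightarrow> 's list pmf" where
  "traj \<kappa> 0 x = return_pmf [x]"
| "traj \<kappa> (Suc n) x = map_pmf ((#) x) (bind_pmf (\<kappa> x) (traj \<kappa> n))"

text \<open>
  The probability that \<open>X\<^sub>1, \<dots>, X\<^sub>n\<close> all lie in \<open>B\<close>. The starting point is exempt, so that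
  \<open>B = E - K\<close> gives the tail of the return time to \<open>K\<close> also for \<open>x \<in> K\<close>.
\<close>

primrec stay :: "('s \<Rightarrow> 's pmf) \<Rightarrow> 's set \<Rightarrow> nat \<Rightarrow> 's \<Rightarrow> ennreal" where
  "stay \<kappa> B 0 x = 1"
| "stay \<kappa> B (Suc n) x = (\<integral>\<^sup>+ y. stay \<kappa> B n y * indicator B y \<partial>\<kappa> x)"

lemma traj_support: "zs \<in> set_pmf (traj \<kappa> n x) \<Longrightarrow> length zs = Suc n \<and> hd zs = x"
  by (induction n arbitrary: x zs) auto

lemma pmf_traj_Cons_Cons:
  "pmf (traj \<kappa> (Suc n) x) (x # y # zs) = pmf (\<kappa> x) y * pmf (traj \<kappa> n y) (y # zs)"
proof -
  have other: "pmf (traj \<kappa> n w) (y # zs) = indicator {y} w * pmf (traj \<kappa> n y) (y # zs)" for w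
    using traj_support[of "y # zs" \<kappa> n w] by (auto simp: indicator_def set_pmf_iff)
  have "pmf (traj \<kappa> (Suc n) x) (x # y # zs) = pmf (bind_pmf (\<kappa> x) (traj \<kappa> n)) (y # zs)"
    by (simp add: pmf_map_inj')
  also have "\<dots> = (\<integral>w. indicator {y} w * pmf (traj \<kappa> n y) (y # zs) \<partial>\<kappa> x)"
    by (simp add: pmf_bind other[symmetric])
  finally show ?thesis
    by (simp add: pmf.rep_eq)
qed

text \<open>
  The Markov property of \<open>absorbed_markov_chain\<close> extends a path by its last step, whereas \<open>traj\<close>
  adds a first step. Both lead to the product of the transition probabilities along the path.
\<close>

lemma pmf_traj_snoc:
  "pmf (traj \<kappa> (Suc n) x) (zs @ [y]) = pmf (traj \<kappa> n x) zs * pmf (\<kappa> (last zs)) y"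
proof (induction n arbitrary: x zs)
  case 0
  show ?case
  proof (cases "zs = [x]")
    case True
    then show ?thesis using pmf_traj_Cons_Cons[of \<kappa> 0 x y "[]"] by simp
  next
    case False
    have "zs @ [y] \<notin> set_pmf (traj \<kappa> (Suc 0) x)"
      using False by (cases zs) auto
    with False show ?thesis by (simp add: pmf_eq_0_set_pmf del: traj.simps(2))
  qed
next
  case (Suc n)
  show ?case
  proof (cases "length zs = Suc (Suc n) \<and> hd zs = x")
    case True
    then obtain w ws where zs: "zs = x # w # ws" by (cases zs; cases "tl zs") auto
    show ?thesis
      using Suc.IH[of w "w # ws"] pmf_traj_Cons_Cons[of \<kappa> "Suc n" x w "ws @ [y]"]
        pmf_traj_Cons_Cons[of \<kappa> n x w ws]
      by (simp add: zs del: traj.simps)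
  next
    case False
    then have "zs @ [y] \<notin> set_pmf (traj \<kappa> (Suc (Suc n)) x)" "zs \<notin> set_pmf (traj \<kappa> (Suc n) x)"
      using traj_support[of "zs @ [y]" \<kappa> "Suc (Suc n)" x] traj_support[of zs \<kappa> "Suc n" x]
      by (cases zs; auto simp del: traj.simps)+
    then have "pmf (traj \<kappa> (Suc (Suc n)) x) (zs @ [y]) = 0" "pmf (traj \<kappa> (Suc n) x) zs = 0"
      by (simp_all only: pmf_eq_0_set_pmf not_False_eq_True)
    then show ?thesis by simp
  qed
qed

lemma map_last_traj: "map_pmf last (traj \<kappa> n x) = kpow \<kappa> n x"
proof (induction n arbitrary: x)
  case (Suc n)
  have "map_pmf last (map_pmf ((#) x) (traj \<kappa> n y)) = map_pmf last (traj \<kappa> n y)" for y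
    unfolding pmf.map_comp
    by (intro map_pmf_cong refl) (auto dest: traj_support)
  then show ?case by (simp add: map_bind_pmf Suc)
qed simp

lemma emeasure_traj_stay:
  "emeasure (traj \<kappa> n x) {zs. set (tl zs) \<subseteq> B} = stay \<kappa> B n x"
proof (induction n arbitrary: x)
  case (Suc n)
  have *: "emeasure (traj \<kappa> n y) {zs. set zs \<subseteq> B} = stay \<kappa> B n y * indicator B y" for y
  proof -
    have "emeasure (traj \<kappa> n y) {zs. set zs \<subseteq> B}
        = emeasure (traj \<kappa> n y) (if y \<in> B then {zs. set (tl zs) \<subseteq> B} else {})"
    proof (intro emeasure_eq_AE AE_pmfI)
      fix zs assume "zs \<in> set_pmf (traj \<kappa> n y)"
      then have "zs = y # tl zs" using traj_support[of zs \<kappa> n y] by (cases zs) auto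
      then have "set zs = insert y (set (tl zs))" by (metis list.simps(15))
      then show "(zs \<in> {zs. set zs \<subseteq> B}) = (zs \<in> (if y \<in> B then {zs. set (tl zs) \<subseteq> B} else {}))"
        by auto
    qed auto
    then show ?thesis by (simp add: Suc.IH split: if_splits)
  qed
  have "emeasure (traj \<kappa> (Suc n) x) {zs. set (tl zs) \<subseteq> B}
      = emeasure (bind_pmf (\<kappa> x) (traj \<kappa> n)) {zs. set zs \<subseteq> B}"
    by (simp add: vimage_def)
  then show ?case by (simp add: * del: traj.simps)
qed simp

lemma stay_Suc_le: "stay \<kappa> B (Suc n) x \<le> stay \<kappa> B n x"
proof (induction n arbitrary: x)
  case 0
  have "(\<integral>\<^sup>+ y. indicator B y \<partial>\<kappa> x) \<le> (\<integral>\<^sup>+ y. 1 \<partial>\<kappa> x)"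
    by (intro nn_integral_mono) (auto simp: indicator_def)
  then show ?case by simp
next
  case (Suc n)
  show ?case
    by (simp only: stay.simps(2)[of _ _ "Suc n"] stay.simps(2)[of _ _ n])
      (intro nn_integral_mono mult_right_mono order.trans[OF _ Suc]; simp)
qed

lemma stay_antimono: "m \<le> n \<Longrightarrow> stay \<kappa> B n x \<le> stay \<kappa> B m x"
  by (rule lift_Suc_antimono_le[of "\<lambda>n. stay \<kappa> B n x"]) (rule stay_Suc_le)

lemma kpow_add: "kpow \<kappa> (m + n) x = bind_pmf (kpow \<kappa> m x) (kpow \<kappa> n)"
proof (induction m arbitrary: x)
  case (Suc m)
  have "kpow \<kappa> (m + n) = (\<lambda>y. bind_pmf (kpow \<kappa> m y) (kpow \<kappa> n))"
    by (rule ext) (rule Suc)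
  then show ?case by (simp add: bind_assoc_pmf)
qed (simp add: bind_return_pmf)

text \<open>
  Only the transitions that pass through \<open>y\<close> are kept.
\<close>

lemma pmf_bind_ge: "pmf M y * pmf (f y) z \<le> pmf (bind_pmf M f) z"
proof -
  have "pmf M y * pmf (f y) z = (\<integral>w. indicator {y} w * pmf (f y) z \<partial>M)"
    by (simp add: pmf.rep_eq)
  also have "\<dots> \<le> (\<integral>w. pmf (f w) z \<partial>M)"
    by (intro integral_mono measure_pmf.integrable_const_bound[where B = 1])
      (auto simp: indicator_def pmf_le_1)
  finally show ?thesis by (simp add: pmf_bind)
qed

lemma pmf_kpow_add_ge: "pmf (kpow \<kappa> m x) y * pmf (kpow \<kappa> n y) z \<le> pmf (kpow \<kappa> (m + n) x) z"
  unfolding kpow_add by (rule pmf_bind_ge)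

section \<open>Generating function of the survival probabilities in a set\<close>

text \<open>
  For \<open>r > 1\<close> this is the exponential moment \<open>(E(r\<^sup>T) - 1) / (r - 1)\<close> of the first time \<open>T \<ge> 1\<close> at
  which the chain is outside \<open>B\<close>, written so that no random time appears.
\<close>

definition stay_gen :: "('s \<Rightarrow> 's pmf) \<Rightarrow> 's set \<Rightarrow> real \<Rightarrow> 's \<Rightarrow> ennreal" where
  "stay_gen \<kappa> B r x = (\<Sum>n. ennreal (r ^ n) * stay \<kappa> B n x)"

text \<open>
  The term \<open>n = 0\<close> is \<open>1\<close>, and the first step of the chain turns the term \<open>n + 1\<close> into \<open>r\<close> times the
  average of the term \<open>n\<close>.
\<close>

lemma stay_gen_eq:
  assumes "r \<ge> 0"
  shows "stay_gen \<kappa> B r x = 1 + ennreal r * (\<integral>\<^sup>+ y. stay_gen \<kappa> B r y * indicator B y \<partial>\<kappa> x)"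
proof -
  have "stay_gen \<kappa> B r x = (\<Sum>n. ennreal (r ^ Suc n) * stay \<kappa> B (Suc n) x) + 1"
    unfolding stay_gen_def
    by (subst suminf_offset[of _ 1]) auto
  also have "(\<Sum>n. ennreal (r ^ Suc n) * stay \<kappa> B (Suc n) x)
      = (\<Sum>n. ennreal r * (\<integral>\<^sup>+ y. ennreal (r ^ n) * stay \<kappa> B n y * indicator B y \<partial>\<kappa> x))"
    using assms by (simp add: ennreal_mult nn_integral_cmult mult.assoc)
  also have "\<dots> = ennreal r * (\<integral>\<^sup>+ y. (\<Sum>n. ennreal (r ^ n) * stay \<kappa> B n y * indicator B y) \<partial>\<kappa> x)"
    by (subst nn_integral_suminf) auto
  finally show ?thesis
    by (simp add: stay_gen_def add.commute)
qed

lemma stay_gen_le_geometric: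
  assumes stay: "\<And>n. stay \<kappa> B n x \<le> ennreal (C * s ^ n)"
    and "0 \<le> C" "0 \<le> s" "0 \<le> r" "r * s < 1"
  shows "stay_gen \<kappa> B r x \<le> ennreal (C / (1 - r * s))"
proof -
  have "stay_gen \<kappa> B r x \<le> (\<Sum>n. ennreal (C * (r * s) ^ n))"
    unfolding stay_gen_def
  proof (intro suminf_le summableI)
    fix n
    have "ennreal (r ^ n) * stay \<kappa> B n x \<le> ennreal (r ^ n) * ennreal (C * s ^ n)"
      using stay by (rule mult_left_mono) simp
    also have "\<dots> = ennreal (C * (r * s) ^ n)"
      using assms by (simp add: ennreal_mult[symmetric] power_mult_distrib mult_ac)
    finally show "ennreal (r ^ n) * stay \<kappa> B n x \<le> ennreal (C * (r * s) ^ n)" .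
  qed
  also have "\<dots> = ennreal (C / (1 - r * s))"
  proof (rule suminf_ennreal_eq)
    have "(\<lambda>n. C * (r * s) ^ n) sums (C * (1 / (1 - r * s)))"
      using assms by (intro sums_mult geometric_sums) auto
    then show "(\<lambda>n. C * (r * s) ^ n) sums (C / (1 - r * s))" by simp
  qed (use assms in auto)
  finally show ?thesis .
qed

section \<open>The law of an absorbed Markov chain\<close>

lemma enat_less_Inf_iff:
  "enat n < Inf {enat k |k. Q k} \<longleftrightarrow> (\<forall>k\<le>n. \<not> Q k)"
proof
  assume less: "enat n < Inf {enat k |k. Q k}"
  show "\<forall>k\<le>n. \<not> Q k"
  proof (intro allI impI notI)
    fix k assume "k \<le> n" "Q k"
    then have "Inf {enat k |k. Q k} \<le> enat k" by (intro Inf_lower) auto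
    then show False using less \<open>k \<le> n\<close> by (meson enat_ord_simps(1) leD order_trans)
  qed
next
  assume "\<forall>k\<le>n. \<not> Q k"
  then have "enat (Suc n) \<le> Inf {enat k |k. Q k}"
    by (intro Inf_greatest) (auto simp: not_less_eq_eq[symmetric])
  then show "enat n < Inf {enat k |k. Q k}"
    by (meson enat_ord_simps(2) lessI less_le_trans)
qed

context absorbed_markov_chain begin

abbreviation states :: "'s set" where
  "states \<equiv> insert cem E"

definition step :: "'s \<Rightarrow> 's pmf" where
  "step x = Abs_pmf (distr (P x) (count_space UNIV) (X 1))"

definition history :: "nat \<Rightarrow> 'w \<Rightarrow> 's list" where
  "history n \<omega> = map (\<lambda>i. X i \<omega>) [0..<Suc n]"

lemma space_P: "x \<in> states \<Longrightarrow> space (P x) = space M"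
  using sets_P by (rule sets_eq_imp_space_eq)

lemma X_in_states: "\<omega> \<in> space M \<Longrightarrow> X n \<omega> \<in> states"
  using measurable_space[OF measurable_X] by simp

lemma set_history: "\<omega> \<in> space M \<Longrightarrow> set (history n \<omega>) \<subseteq> states"
  unfolding history_def set_map using X_in_states by blast

lemma measurable_X_UNIV:
  assumes "x \<in> states"
  shows "X i \<in> measurable (P x) (count_space UNIV)"
proof -
  have "X i \<in> measurable M (count_space UNIV)"
    by (rule measurable_compose[OF measurable_X]) simp
  then show ?thesis using sets_P[OF assms] by (simp cong: measurable_cong_sets)
qed

lemma measurable_history:
  assumes "x \<in> states"
  shows "history n \<in> measurable (P x) (count_space UNIV)"
proof -
  note [measurable] = measurable_X_UNIV[OF assms]
  have "countable (lists states)"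
    using countable_E by (intro countable_lists) simp
  moreover have "history n \<in> space (P x) \<rightarrow> lists states"
    using set_history by (simp add: space_P[OF assms] in_lists_conv_set Pi_iff subset_iff)
  moreover have "history n -` {zs} \<inter> space (P x) \<in> sets (P x)" for zs
  proof -
    have "history n -` {zs} \<inter> space (P x) =
        {\<omega> \<in> space (P x). length zs = Suc n \<and> (\<forall>i<Suc n. X i \<omega> = zs ! i)}"
      by (auto simp: history_def list_eq_iff_nth_eq simp del: upt_Suc)
    also have "\<dots> \<in> sets (P x)" by measurable
    finally show ?thesis .
  qed
  ultimately have "history n \<in> measurable (P x) (count_space (lists states))"
    by (subst measurable_count_space_eq_countable) auto
  then show ?thesis by (rule measurable_compose) simp
qed

text \<open>
  The state space is countable, so the law of \<open>X\<^sub>1\<close> charges only atoms and is a genuine \<open>pmf\<close>.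
\<close>

lemma measure_step:
  assumes x: "x \<in> states"
  shows "measure_pmf (step x) = distr (P x) (count_space UNIV) (X 1)"
proof -
  interpret prob_space "P x" by (rule prob_space_P[OF x])
  let ?D = "distr (P x) (count_space UNIV) (X 1)"
  interpret D: prob_space ?D
    by (rule prob_space_distr[OF measurable_X_UNIV[OF x]])
  have "AE y in P x. X 1 y \<in> states"
    using X_in_states by (intro AE_I2) (simp add: space_P[OF x] del: insert_iff)
  then have "AE y in ?D. y \<in> states"
    by (subst AE_distr_iff) (auto simp: measurable_X_UNIV[OF x])
  moreover have "countable states" using countable_E by simp
  ultimately have "AE y in ?D. measure ?D {y} \<noteq> 0"
    by (subst D.AE_support_countable) auto
  then have "?D \<in> {M. prob_space M \<and> sets M = UNIV \<and> (AE y in M. measure M {y} \<noteq> 0)}"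
    using D.prob_space_axioms by (simp del: One_nat_def)
  then show ?thesis unfolding step_def by (rule Abs_pmf_inverse)
qed

lemma pmf_step: "x \<in> states \<Longrightarrow> pmf (step x) y = \<P>(\<omega> in P x. X 1 \<omega> = y)"
  by (auto simp: pmf.rep_eq measure_step measure_distr measurable_X_UNIV vimage_def
      intro!: arg_cong[where f = "measure (P x)"])

lemma step_in_states:
  assumes "x \<in> states"
  shows "set_pmf (step x) \<subseteq> states"
proof
  fix y assume "y \<in> set_pmf (step x)"
  then have "{\<omega> \<in> space (P x). X 1 \<omega> = y} \<noteq> {}"
    using pmf_step[OF assms, of y] by (metis measure_empty set_pmf_iff)
  then show "y \<in> states"
    using X_in_states space_P[OF assms] by auto
qed

lemma step_cem: "step cem = return_pmf cem"
proof -
  have "pmf (step cem) cem = 1" using pmf_step[of cem cem] absorbing by simp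
  then have "measure (step cem) {cem} = 1" by (simp add: pmf.rep_eq)
  then have "AE y in step cem. y = cem"
    using measure_pmf.prob_eq_1[of "{cem}" "step cem"] by simp
  then have "set_pmf (step cem) \<subseteq> {cem}" by (auto simp: AE_measure_pmf_iff)
  then show ?thesis by (simp add: set_pmf_subset_singleton)
qed

lemma sets_all_X:
  assumes "x \<in> states" "finite I"
  shows "{\<omega> \<in> space (P x). \<forall>i\<in>I. X i \<omega> \<in> A i} \<in> sets (P x)"
proof (intro sets.sets_Collect_finite_All assms)
  fix i
  have "{\<omega> \<in> space (P x). X i \<omega> \<in> A i} = X i -` A i \<inter> space (P x)" by auto
  also have "\<dots> \<in> sets (P x)" by (intro measurable_sets[OF measurable_X_UNIV[OF assms(1)]]) simp
  finally show "{\<omega> \<in> space (P x). X i \<omega> \<in> A i} \<in> sets (P x)" .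
qed

lemma AE_start:
  assumes x: "x \<in> states"
  shows "AE \<omega> in P x. X 0 \<omega> = x"
proof -
  interpret prob_space "P x" by (rule prob_space_P[OF x])
  have "{\<omega> \<in> space (P x). X 0 \<omega> = x} \<in> sets (P x)"
    using sets_all_X[OF x, of "{0}" "\<lambda>_. {x}"] by simp
  then show ?thesis
    using start[OF x] by (subst (asm) prob_Collect_eq_1) auto
qed

lemma prob_start:
  assumes x: "x \<in> states"
  shows "\<P>(\<omega> in P x. X 0 \<omega> = z) = indicator {x} z"
proof (cases "z = x")
  case True
  then show ?thesis using start[OF x] by simp
next
  case False
  interpret prob_space "P x" by (rule prob_space_P[OF x])
  have "AE \<omega> in P x. X 0 \<omega> \<noteq> z"
    using AE_start[OF x] by eventually_elim (use False in auto)
  then show ?thesis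
    using False by (simp add: prob_eq_0_AE)
qed

text \<open>
  Both sides are multiplied by the same transition probability when a last state is appended.
\<close>

lemma prob_history_singleton:
  assumes x: "x \<in> states"
  shows "length zs = Suc n \<Longrightarrow> set zs \<subseteq> states \<Longrightarrow>
    \<P>(\<omega> in P x. history n \<omega> = zs) = pmf (traj step n x) zs"
proof (induction n arbitrary: zs)
  case 0
  then obtain z where "zs = [z]" by (cases zs) auto
  then show ?case using prob_start[OF x, of z] by (simp add: history_def indicator_def)
next
  case (Suc n)
  have history_eq: "history m \<omega> = ws \<longleftrightarrow> (\<forall>i\<le>m. X i \<omega> = ws ! i)" if "length ws = Suc m" for m \<omega> ws
    using that by (auto simp: history_def list_eq_iff_nth_eq less_Suc_eq_le simp del: upt_Suc)
  from Suc.prems obtain ws y where zs: "zs = ws @ [y]" "length ws = Suc n"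
    by (cases zs rule: rev_cases) auto
  have nth: "zs ! i = ws ! i" if "i \<le> n" for i
    using that zs by (simp add: nth_append)
  have "\<P>(\<omega> in P x. history (Suc n) \<omega> = zs) = \<P>(\<omega> in P x. \<forall>i\<le>Suc n. X i \<omega> = zs ! i)"
    using Suc.prems by (simp add: history_eq)
  also have "\<dots> = \<P>(\<omega> in P x. \<forall>i\<le>n. X i \<omega> = zs ! i) * \<P>(\<omega> in P (zs ! n). X 1 \<omega> = zs ! Suc n)"
    using Suc.prems by (intro markov x) (simp add: subset_code(1) del: insert_iff)
  also have "\<P>(\<omega> in P x. \<forall>i\<le>n. X i \<omega> = zs ! i) = \<P>(\<omega> in P x. history n \<omega> = ws)"
    using zs nth by (simp add: history_eq)
  also have "\<dots> = pmf (traj step n x) ws"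
    using Suc zs by auto
  also have "\<P>(\<omega> in P (zs ! n). X 1 \<omega> = zs ! Suc n) = pmf (step (last ws)) y"
  proof -
    have "zs ! n = last ws" "zs ! Suc n = y"
      using zs by (cases ws rule: rev_cases; simp add: nth_append)+
    moreover have "last ws \<in> states"
      using zs Suc.prems(2) last_in_set[of ws]
      by (metis Suc_neq_Zero in_mono last_in_set le_sup_iff list.size(3) set_append)
    ultimately show ?thesis by (simp add: pmf_step)
  qed
  finally show ?case by (simp only: zs pmf_traj_snoc)
qed

text \<open>
  Both measures live on the countable set of lists of \<open>n + 1\<close> states, so agreement on singletons
  is enough.
\<close>

lemma measure_traj:
  assumes x: "x \<in> states"
  shows "measure_pmf (traj step n x) = distr (P x) (count_space UNIV) (history n)"
proof -
  interpret prob_space "P x" by (rule prob_space_P[OF x])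
  let ?L = "{zs. length zs = Suc n \<and> zs \<in> lists states}"
  have traj_states: "set zs \<subseteq> states" if "y \<in> states" "zs \<in> set_pmf (traj step n y)" for n y zs
    using that
  proof (induction n arbitrary: y zs)
    case (Suc n)
    then show ?case using step_in_states[of y] by fastforce
  qed auto
  show ?thesis
  proof (rule measure_eqI_countable_AE)
    show "AE zs in traj step n x. zs \<in> ?L"
      using traj_states[OF x] by (auto intro!: AE_pmfI dest: traj_support)
    have "AE \<omega> in P x. history n \<omega> \<in> ?L"
      using set_history
      by (intro AE_I2) (auto simp: space_P[OF x] in_lists_conv_set subset_iff history_def)
    then show "AE zs in distr (P x) (count_space UNIV) (history n). zs \<in> ?L"
      by (subst AE_distr_iff) (auto simp: measurable_history[OF x])
    have "countable (lists states)"
      using countable_E by (intro countable_lists) simp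
    then show "countable ?L" by (rule countable_subset[rotated]) auto
    fix zs assume "zs \<in> ?L"
    then have "pmf (traj step n x) zs = \<P>(\<omega> in P x. history n \<omega> = zs)"
      by (subst prob_history_singleton[OF x]) auto
    also have "\<dots> = measure (distr (P x) (count_space UNIV) (history n)) {zs}"
      by (auto simp: measure_distr measurable_history[OF x] vimage_def
          intro!: arg_cong[where f = prob])
    finally show "emeasure (traj step n x) {zs} = emeasure (distr (P x) (count_space UNIV) (history n)) {zs}"
      by (simp add: emeasure_pmf_single emeasure_distr measure_distr measurable_history[OF x] emeasure_eq_measure)
  qed auto
qed

lemma prob_history:
  assumes x: "x \<in> states"
  shows "emeasure (P x) {\<omega> \<in> space (P x). history n \<omega> \<in> Z} = emeasure (traj step n x) Z"
  by (auto simp: measure_traj[OF x] emeasure_distr measurable_history[OF x]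
      intro!: arg_cong[where f = "emeasure (P x)"])

lemma prob_X:
  assumes x: "x \<in> states"
  shows "\<P>(\<omega> in P x. X n \<omega> = y) = pmf (kpow step n x) y"
proof -
  interpret prob_space "P x" by (rule prob_space_P[OF x])
  have "ennreal \<P>(\<omega> in P x. X n \<omega> = y) = emeasure (P x) {\<omega> \<in> space (P x). history n \<omega> \<in> {zs. last zs = y}}"
    by (simp add: emeasure_eq_measure history_def)
  also have "\<dots> = emeasure (map_pmf last (traj step n x)) {y}"
    unfolding prob_history[OF x] by (simp add: vimage_def)
  also have "\<dots> = ennreal (pmf (kpow step n x) y)"
    by (simp add: map_last_traj emeasure_pmf_single)
  finally show ?thesis by simp
qed

lemma prob_stay:
  assumes x: "x \<in> states"
  shows "ennreal \<P>(\<omega> in P x. \<forall>i\<in>{1..n}. X i \<omega> \<in> B) = stay step B n x"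
proof -
  interpret prob_space "P x" by (rule prob_space_P[OF x])
  have "set (tl (history n \<omega>)) = (\<lambda>i. X i \<omega>) ` {1..n}" for \<omega>
  proof -
    have "tl (history n \<omega>) = map (\<lambda>i. X i \<omega>) [1..<Suc n]"
      by (simp add: history_def upt_conv_Cons del: upt_Suc)
    then show ?thesis by (auto simp: atLeastLessThanSuc_atLeastAtMost simp del: upt_Suc)
  qed
  then have "ennreal \<P>(\<omega> in P x. \<forall>i\<in>{1..n}. X i \<omega> \<in> B)
    = emeasure (P x) {\<omega> \<in> space (P x). history n \<omega> \<in> {zs. set (tl zs) \<subseteq> B}}"
    by (simp add: emeasure_eq_measure image_subset_iff)
  then show ?thesis unfolding prob_history[OF x] emeasure_traj_stay .
qed

text \<open>
  The event fixes nothing about \<open>K\<close> at time \<open>0\<close>, and \<open>X\<^sub>0 = x \<noteq> cem\<close> holds only almost surely; up to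
  a null set it is the event that \<open>X\<^sub>1, \<dots>, X\<^sub>n\<close> lie in \<open>E - K\<close>.
\<close>

lemma prob_survival_outside:
  assumes x: "x \<in> E" and K: "K \<subseteq> E"
  shows "ennreal \<P>(\<omega> in P x. enat n < min (return_time X K \<omega>) (absorption_time X cem \<omega>))
    = stay step (E - K) n x"
proof -
  have xs: "x \<in> states" using x by simp
  interpret prob_space "P x" by (rule prob_space_P[OF xs])
  let ?A = "\<lambda>i. - ({cem} \<union> (if 1 \<le> i then K else {}))"
  have time_iff: "enat n < min (return_time X K \<omega>) (absorption_time X cem \<omega>) \<longleftrightarrow>
      (\<forall>i\<in>{..n}. X i \<omega> \<in> ?A i)" for \<omega>
    unfolding min_less_iff_conj return_time_def absorption_time_def enat_less_Inf_iff by auto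
  have "\<P>(\<omega> in P x. \<forall>i\<in>{..n}. X i \<omega> \<in> ?A i) = \<P>(\<omega> in P x. \<forall>i\<in>{1..n}. X i \<omega> \<in> E - K)"
  proof (rule finite_measure_eq_AE)
    show "AE \<omega> in P x. (\<omega> \<in> {\<omega> \<in> space (P x). \<forall>i\<in>{..n}. X i \<omega> \<in> ?A i}) =
        (\<omega> \<in> {\<omega> \<in> space (P x). \<forall>i\<in>{1..n}. X i \<omega> \<in> E - K})"
      using AE_start[OF xs] AE_space
    proof eventually_elim
      fix \<omega> assume start_x: "X 0 \<omega> = x" and \<omega>: "\<omega> \<in> space (P x)"
      have "X i \<omega> \<noteq> cem \<longleftrightarrow> X i \<omega> \<in> E" for i
        using X_in_states[of \<omega> i] \<omega> cem_notin_E by (auto simp: space_P[OF xs])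
      then have in_A: "X i \<omega> \<in> ?A i \<longleftrightarrow> X i \<omega> \<in> E \<and> (1 \<le> i \<longrightarrow> X i \<omega> \<notin> K)" for i
        by auto
      have "(\<forall>i\<in>{..n}. X i \<omega> \<in> ?A i) \<longleftrightarrow> (\<forall>i\<in>{1..n}. X i \<omega> \<in> E - K)"
        unfolding in_A
      proof (intro iffI ballI)
        fix i assume all: "\<forall>i\<in>{1..n}. X i \<omega> \<in> E - K" and "i \<in> {..n}"
        then show "X i \<omega> \<in> E \<and> (1 \<le> i \<longrightarrow> X i \<omega> \<notin> K)"
          using start_x x by (cases i) auto
      qed auto
      then show "(\<omega> \<in> {\<omega> \<in> space (P x). \<forall>i\<in>{..n}. X i \<omega> \<in> ?A i}) =
          (\<omega> \<in> {\<omega> \<in> space (P x). \<forall>i\<in>{1..n}. X i \<omega> \<in> E - K})"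
        by blast
    qed
  qed (intro sets_all_X[OF xs] finite_atMost finite_atLeastAtMost)+
  then show ?thesis using prob_stay[OF xs] by (simp only: time_iff)
qed

lemma prob_survival:
  assumes x: "x \<in> E"
  shows "ennreal \<P>(\<omega> in P x. enat n < absorption_time X cem \<omega>) = stay step E n x"
proof -
  \<comment> \<open>Survival is the case \<open>K = {}\<close>, in which the return time is infinite.\<close>
  have "return_time X {} \<omega> = \<infinity>" for \<omega>
    by (simp add: return_time_def flip: top_enat_def)
  then show ?thesis using prob_survival_outside[OF x, of "{}" n] by simp
qed

lemma P1_op_eq:
  assumes x: "x \<in> E"
  shows "P1_op cem P X f x = (\<integral>\<^sup>+ y. ennreal (f y) * indicator E y \<partial>step x)"
proof -
  have xs: "x \<in> states" using x by simp
  interpret prob_space "P x" by (rule prob_space_P[OF xs])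
  note [measurable] = measurable_X_UNIV[OF xs]
  have iff1: "1 < absorption_time X cem \<omega> \<longleftrightarrow> X 0 \<omega> \<noteq> cem \<and> X 1 \<omega> \<noteq> cem" for \<omega>
    unfolding absorption_time_def one_enat_def enat_less_Inf_iff
    by (auto simp: le_Suc_eq)
  have iff2: "X 1 \<omega> \<noteq> cem \<longleftrightarrow> X 1 \<omega> \<in> E" if "\<omega> \<in> space (P x)" for \<omega>
    using X_in_states[of \<omega> 1] that cem_notin_E by (auto simp: space_P[OF xs])
  have x_cem: "x \<noteq> cem" using x cem_notin_E by auto
  have "AE \<omega> in P x. ennreal (f (X 1 \<omega>)) * indicator {\<omega>. 1 < absorption_time X cem \<omega>} \<omega>
      = ennreal (f (X 1 \<omega>)) * indicator E (X 1 \<omega>)"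
    using AE_start[OF xs] AE_space
  proof eventually_elim
    fix \<omega> assume "X 0 \<omega> = x" "\<omega> \<in> space (P x)"
    with iff1 iff2 x_cem
    show "ennreal (f (X 1 \<omega>)) * indicator {\<omega>. 1 < absorption_time X cem \<omega>} \<omega>
      = ennreal (f (X 1 \<omega>)) * indicator E (X 1 \<omega>)"
      by (simp add: indicator_def del: One_nat_def)
  qed
  then have "P1_op cem P X f x = (\<integral>\<^sup>+ \<omega>. ennreal (f (X 1 \<omega>)) * indicator E (X 1 \<omega>) \<partial>P x)"
    unfolding P1_op_def by (rule nn_integral_cong_AE)
  also have "\<dots> = (\<integral>\<^sup>+ y. ennreal (f y) * indicator E y \<partial>step x)"
    by (simp add: measure_step[OF xs] nn_integral_distr)
  finally show ?thesis .
qed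

section \<open>Comparing survival probabilities through visits to a state\<close>

lemma kpow_cem: "kpow step n cem = return_pmf cem"
  by (induction n) (simp_all add: step_cem bind_return_pmf)

text \<open>
  Going to \<open>y\<close> in \<open>k\<close> steps and then surviving \<open>m\<close> steps is one way to survive \<open>k + m\<close> steps: a
  path that is at \<open>y \<in> E\<close> at time \<open>k\<close> cannot have been absorbed before.
\<close>

lemma survival_ge_visit:
  assumes "y \<in> E" "x \<in> states"
  shows "ennreal (pmf (kpow step k x) y) * stay step E m y \<le> stay step E (k + m) x"
  using assms(2)
proof (induction k arbitrary: x)
  case 0
  then show ?case by (simp add: indicator_def)
next
  case (Suc k)
  have "ennreal (pmf (kpow step (Suc k) x) y) * stay step E m y
      = (\<integral>\<^sup>+ w. ennreal (pmf (kpow step k w) y) * stay step E m y \<partial>step x)"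
    by (simp add: ennreal_pmf_bind nn_integral_multc)
  also have "\<dots> \<le> (\<integral>\<^sup>+ w. stay step E (k + m) w * indicator E w \<partial>step x)"
  proof (intro nn_integral_mono_AE AE_pmfI)
    fix w assume "w \<in> set_pmf (step x)"
    then have "w \<in> states" using step_in_states[OF Suc.prems] by blast
    moreover have "pmf (kpow step k cem) y = 0"
      using assms(1) cem_notin_E by (auto simp: kpow_cem indicator_def)
    ultimately show "ennreal (pmf (kpow step k w) y) * stay step E m y
        \<le> stay step E (k + m) w * indicator E w"
      using Suc.IH[of w] by (auto simp: indicator_def)
  qed
  finally show ?case by simp
qed

text \<open>
  Survival up to time \<open>n\<close> is more likely than survival up to time \<open>k + n\<close>, so the bound is uniform
  in the visiting time \<open>k\<close>.
\<close>

lemma survival_ge_if_visit: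
  assumes "y \<in> E" "x \<in> states" "\<delta> \<le> pmf (kpow step k x) y"
  shows "ennreal \<delta> * stay step E n y \<le> stay step E n x"
proof -
  have "ennreal \<delta> * stay step E n y \<le> ennreal (pmf (kpow step k x) y) * stay step E n y"
    using assms by (intro mult_right_mono ennreal_leI) auto
  also have "\<dots> \<le> stay step E (k + n) x" by (rule survival_ge_visit[OF assms(1,2)])
  also have "\<dots> \<le> stay step E n x" by (rule stay_antimono) simp
  finally show ?thesis .
qed

lemma survival_pos:
  assumes "x \<in> E" and aper: "\<forall>n\<ge>N. pmf (kpow step n x) x > 0"
  shows "stay step E n x > 0"
proof -
  have "0 < ennreal (pmf (kpow step (n + N) x) x)" using aper by simp
  also have "\<dots> \<le> stay step E (n + N) x"
    using survival_ge_visit[of x x "n + N" 0] assms by simp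
  also have "\<dots> \<le> stay step E n x" by (rule stay_antimono) simp
  finally show ?thesis .
qed

text \<open>
  A union bound over the \<open>n + 1\<close> possible visiting times.
\<close>

lemma hitting_imp_visit:
  assumes x: "x \<in> states" and C: "C \<le> \<P>(\<omega> in P x. hitting_time X {y} \<omega> \<le> enat n)"
  shows "\<exists>k\<le>n. C / (n + 1) \<le> pmf (kpow step k x) y"
proof (rule ccontr)
  interpret prob_space "P x" by (rule prob_space_P[OF x])
  assume "\<not> (\<exists>k\<le>n. C / (n + 1) \<le> pmf (kpow step k x) y)"
  then have less: "pmf (kpow step k x) y < C / (n + 1)" if "k \<le> n" for k
    using that by (meson not_le)
  have "hitting_time X {y} \<omega> \<le> enat n \<longleftrightarrow> (\<exists>k\<le>n. X k \<omega> = y)" for \<omega>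
    unfolding hitting_time_def not_less[symmetric] enat_less_Inf_iff by simp
  then have "\<P>(\<omega> in P x. hitting_time X {y} \<omega> \<le> enat n) = prob (\<Union>k\<le>n. {\<omega> \<in> space (P x). X k \<omega> = y})"
    by (auto intro!: arg_cong[where f = prob])
  also have "\<dots> \<le> (\<Sum>k\<le>n. \<P>(\<omega> in P x. X k \<omega> = y))"
    by (intro finite_measure_subadditive_finite) (use sets_all_X[OF x, of "{_}" "\<lambda>_. {y}"] in auto)
  also have "\<dots> = (\<Sum>k\<le>n. pmf (kpow step k x) y)"
    by (simp add: prob_X[OF x])
  also have "\<dots> < (\<Sum>k\<le>n. C / (n + 1))"
    using less by (intro sum_strict_mono) auto
  also have "\<dots> = C" by simp
  finally show False using C by simp
qed

section \<open>The drift functions\<close>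

text \<open>
  Finiteness at \<open>z\<close> passes to every state \<open>w \<in> E\<close> with a positive transition probability from \<open>z\<close>:
  outside \<open>K\<close> because the integral in \<open>stay_gen_eq\<close> is finite, and in \<open>K\<close> by hypothesis. A path from
  \<open>z\<close> to \<open>y \<in> E\<close> never meets \<open>cem\<close>, so this can be iterated along it.
\<close>

lemma stay_gen_finite_reachable:
  assumes K: "\<forall>k\<in>K. stay_gen step (E - K) r k < \<infinity>" and r: "r > 0"
  shows "z \<in> E \<Longrightarrow> stay_gen step (E - K) r z < \<infinity> \<Longrightarrow> y \<in> E \<Longrightarrow> y \<in> set_pmf (kpow step n z) \<Longrightarrow>
    stay_gen step (E - K) r y < \<infinity>"
proof (induction n arbitrary: z)
  case (Suc n)
  let ?G = "stay_gen step (E - K) r"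
  from Suc.prems obtain w where w: "w \<in> set_pmf (step z)" "y \<in> set_pmf (kpow step n w)"
    by auto
  have "w \<noteq> cem" using w(2) Suc.prems(3) cem_notin_E by (auto simp: kpow_cem)
  then have "w \<in> E" using w(1) step_in_states[of z] Suc.prems(1) by auto
  moreover have "?G w < \<infinity>"
  proof (cases "w \<in> K")
    case True
    then show ?thesis using K by blast
  next
    case False
    have "(\<integral>\<^sup>+ y. ?G y * indicator (E - K) y \<partial>step z) < \<infinity>"
      using Suc.prems(2) r
      by (subst (asm) stay_gen_eq) (auto simp: ennreal_mult_less_top)
    then have "AE y in step z. ?G y * indicator (E - K) y \<noteq> \<infinity>"
      by (intro nn_integral_PInf_AE) auto
    then show ?thesis
      using w(1) False \<open>w \<in> E\<close> by (auto simp: AE_measure_pmf_iff less_top)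
  qed
  ultimately show ?case using Suc.IH[of w] Suc.prems(3) w(2) by blast
qed auto

text \<open>
  Let \<open>G\<close> be the generating function. The function is \<open>1\<close> on \<open>K\<close> and \<open>G / \<theta>\<close> elsewhere. Its
  image under \<open>P\<^sub>1\<close> is at most \<open>1 + \<theta>\<^sup>-\<^sup>1 P\<^sub>1(G 1\<^bsub>E - K\<^esub>) = G\<close>, which equals \<open>\<theta> \<phi>\<close> off \<open>K\<close> and is at most
  \<open>c\<close> on \<open>K\<close>. The factor \<open>1 / \<theta>\<close> off \<open>K\<close> is what leaves room for the mass \<open>P\<^sub>1 1\<^sub>K \<le> 1\<close>,
  and \<open>\<theta> < 1\<close> then gives \<open>\<phi> \<ge> 1\<close>.
\<close>

lemma upper_drift_function:
  assumes "K \<subseteq> E" "0 < \<theta>" "\<theta> < 1"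
    and bound: "\<forall>x\<in>K. stay_gen step (E - K) (1 / \<theta>) x \<le> ennreal c"
    and finite: "\<forall>x\<in>E. stay_gen step (E - K) (1 / \<theta>) x < \<infinity>"
  obtains \<phi> :: "'s \<Rightarrow> real" where "\<forall>x\<in>E. \<phi> x \<ge> 1" "\<forall>x\<in>K. \<phi> x = 1"
    "\<forall>x\<in>E. P1_op cem P X \<phi> x \<le> ennreal (\<theta> * \<phi> x + c * indicator K x)"
proof -
  let ?G = "stay_gen step (E - K) (1 / \<theta>)"
  define \<phi> where "\<phi> = (\<lambda>x. if x \<in> K then 1 else (1 / \<theta>) * enn2real (?G x))"
  have G: "?G x = 1 + ennreal (1 / \<theta>) * (\<integral>\<^sup>+ y. ?G y * indicator (E - K) y \<partial>step x)" for x
    using assms by (intro stay_gen_eq) auto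
  have ennreal_G: "ennreal (enn2real (?G x)) = ?G x" if "x \<in> E" for x
    using finite that by simp
  have G_ge: "1 \<le> enn2real (?G x)" if "x \<in> E" for x
  proof -
    have "ennreal 1 \<le> ?G x" by (subst G) simp
    then have "ennreal 1 \<le> ennreal (enn2real (?G x))" by (simp only: ennreal_G[OF that])
    then show ?thesis by (subst (asm) ennreal_le_iff) auto
  qed
  have le_G: "P1_op cem P X \<phi> x \<le> ?G x" if "x \<in> E" for x
  proof -
    have "P1_op cem P X \<phi> x \<le> (\<integral>\<^sup>+ y. 1 + ennreal (1 / \<theta>) * (?G y * indicator (E - K) y) \<partial>step x)"
      unfolding P1_op_eq[OF that]
    proof (intro nn_integral_mono)
      fix y
      show "ennreal (\<phi> y) * indicator E y \<le> 1 + ennreal (1 / \<theta>) * (?G y * indicator (E - K) y)"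
      proof (cases "y \<in> E - K")
        case True
        then have "ennreal (\<phi> y) = ennreal (1 / \<theta>) * ?G y"
          using assms by (simp add: \<phi>_def ennreal_mult ennreal_G del: times_divide_eq_left)
        then show ?thesis using True by simp
      qed (auto simp: \<phi>_def indicator_def)
    qed
    also have "\<dots> = ?G x"
      by (subst G) (simp add: nn_integral_add nn_integral_cmult)
    finally show ?thesis .
  qed
  show ?thesis
  proof
    show "\<forall>x\<in>K. \<phi> x = 1" by (simp add: \<phi>_def)
    show "\<forall>x\<in>E. \<phi> x \<ge> 1"
    proof
      fix x assume "x \<in> E"
      then have "1 * 1 \<le> (1 / \<theta>) * enn2real (?G x)"
        using assms by (intro mult_mono G_ge) auto
      then show "\<phi> x \<ge> 1" by (simp add: \<phi>_def)
    qed
    show "\<forall>x\<in>E. P1_op cem P X \<phi> x \<le> ennreal (\<theta> * \<phi> x + c * indicator K x)"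
    proof
      fix x assume x: "x \<in> E"
      show "P1_op cem P X \<phi> x \<le> ennreal (\<theta> * \<phi> x + c * indicator K x)"
      proof (cases "x \<in> K")
        case True
        then have "P1_op cem P X \<phi> x \<le> ennreal c" using le_G[OF x] bound by force
        also have "\<dots> \<le> ennreal (\<theta> * \<phi> x + c * indicator K x)"
          using True assms by (intro ennreal_leI) (simp add: \<phi>_def)
        finally show ?thesis .
      next
        case False
        then have "\<theta> * \<phi> x + c * indicator K x = enn2real (?G x)"
          using assms by (simp add: \<phi>_def)
        then show ?thesis using le_G[OF x] ennreal_G[OF x] by simp
      qed
    qed
  qed
qed

text \<open>
  With \<open>r = 1 / \<theta>\<close> and \<open>a\<^sub>k(x)\<close> the probability of being at \<open>x\<^sub>0\<close> after \<open>k\<close> steps, the function is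
  proportional to \<open>\<Sum>k<l. r\<^sup>k a\<^sub>k\<close>. Since \<open>P\<^sub>1 a\<^sub>k = a\<^bsub>k + 1\<^esub>\<close>, the operator \<open>r P\<^sub>1\<close> shifts the sum and changes
  it by \<open>r\<^sup>l a\<^sub>l - a\<^sub>0\<close>. As \<open>a\<^sub>0\<close> is the indicator of \<open>x\<^sub>0\<close>, this is nonnegative everywhere once it is so
  at \<open>x\<^sub>0\<close>, which is the hypothesis on the return probability.
\<close>

lemma lower_drift_function:
  assumes x0: "x\<^sub>0 \<in> E" and \<theta>: "0 < \<theta>" "\<theta> < 1" and l: "l > 0"
    and ret: "\<theta> ^ l \<le> pmf (kpow step l x\<^sub>0) x\<^sub>0"
  obtains \<phi> :: "'s \<Rightarrow> real" and c :: real
  where "\<forall>x\<in>E. 0 \<le> \<phi> x \<and> \<phi> x \<le> 1" "c > 0"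
    "\<forall>x\<in>E. \<forall>k<l. c * pmf (kpow step k x) x\<^sub>0 \<le> \<phi> x"
    "\<forall>x\<in>E. P1_op cem P X \<phi> x \<ge> ennreal (\<theta> * \<phi> x)"
proof -
  define r where "r = 1 / \<theta>"
  have r: "r > 1" "\<theta> * r = 1" using \<theta> by (auto simp: r_def)
  define Z where "Z = (\<Sum>k<l. r ^ k)"
  define a where "a = (\<lambda>k x. pmf (kpow step k x) x\<^sub>0)"
  define \<phi> where "\<phi> = (\<lambda>x. (\<Sum>k<l. r ^ k * a k x) / Z)"
  have a01: "0 \<le> a k x" "a k x \<le> 1" for k x by (auto simp: a_def pmf_le_1)
  have Z: "Z > 0" unfolding Z_def using r l by (intro sum_pos) auto
  have \<phi>01: "0 \<le> \<phi> x" "\<phi> x \<le> 1" for x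
  proof -
    show "0 \<le> \<phi> x" unfolding \<phi>_def using r Z a01 by (intro divide_nonneg_pos sum_nonneg) auto
    have "(\<Sum>k<l. r ^ k * a k x) \<le> Z"
      unfolding Z_def using r a01 by (intro sum_mono) (simp add: mult_left_le)
    then show "\<phi> x \<le> 1" using Z by (simp add: \<phi>_def)
  qed
  show ?thesis
  proof (rule that[of \<phi> "1 / Z"])
    show "\<forall>x\<in>E. 0 \<le> \<phi> x \<and> \<phi> x \<le> 1" using \<phi>01 by blast
    show "1 / Z > 0" using Z by simp
    show "\<forall>x\<in>E. \<forall>k<l. 1 / Z * pmf (kpow step k x) x\<^sub>0 \<le> \<phi> x"
    proof (intro ballI allI impI)
      fix x k assume k: "k < l"
      have "a k x \<le> r ^ k * a k x"
        using r a01[of k x] mult_right_mono[of 1 "r ^ k" "a k x"] by simp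
      also have "\<dots> \<le> (\<Sum>k<l. r ^ k * a k x)"
        using r a01 k by (intro member_le_sum) auto
      finally show "1 / Z * pmf (kpow step k x) x\<^sub>0 \<le> \<phi> x"
        using Z by (simp add: \<phi>_def a_def divide_right_mono)
    qed
    show "\<forall>x\<in>E. P1_op cem P X \<phi> x \<ge> ennreal (\<theta> * \<phi> x)"
    proof
      fix x assume x: "x \<in> E"
      have int: "integrable (step x) f" if "\<And>y. 0 \<le> f y" "\<And>y. f y \<le> 1" for f :: "'s \<Rightarrow> real"
        using that by (intro measure_pmf.integrable_const_bound[where B = 1]) auto
      have "\<phi> cem = 0"
        using x0 cem_notin_E by (auto simp: \<phi>_def a_def kpow_cem indicator_def intro!: sum.neutral)
      then have "P1_op cem P X \<phi> x = (\<integral>\<^sup>+ y. ennreal (\<phi> y) \<partial>step x)"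
        unfolding P1_op_eq[OF x] using step_in_states[of x] x
        by (intro nn_integral_cong_AE AE_pmfI) (auto simp: indicator_def)
      also have "\<dots> = ennreal (\<integral>y. \<phi> y \<partial>step x)"
        using \<phi>01 by (intro nn_integral_eq_integral int) auto
      also have "(\<integral>y. \<phi> y \<partial>step x) = (\<Sum>k<l. r ^ k * a (Suc k) x) / Z"
        using a01 by (simp add: \<phi>_def int a_def pmf_bind)
      finally have P1: "P1_op cem P X \<phi> x = ennreal ((\<Sum>k<l. r ^ k * a (Suc k) x) / Z)" .
      have "\<theta> * \<phi> x \<le> (\<Sum>k<l. r ^ k * a (Suc k) x) / Z"
      proof -
        have a0: "a 0 x \<le> r ^ l * a l x"
        proof (cases "x = x\<^sub>0")
          case True
          have "1 = r ^ l * \<theta> ^ l" using r by (simp add: mult.commute flip: power_mult_distrib)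
          also have "\<dots> \<le> r ^ l * a l x"
            using ret r True by (intro mult_left_mono) (auto simp: a_def)
          finally show ?thesis using True by (simp add: a_def)
        next
          case False
          then show ?thesis using r a01 by (simp add: a_def)
        qed
        have "(\<Sum>k<l. r ^ k * a k x) + r ^ l * a l x = a 0 x + (\<Sum>k<l. r ^ Suc k * a (Suc k) x)"
          using sum.lessThan_Suc_shift[of "\<lambda>k. r ^ k * a k x" l] by simp
        then have "(\<Sum>k<l. r ^ k * a k x) \<le> r * (\<Sum>k<l. r ^ k * a (Suc k) x)"
          using a0 by (simp add: sum_distrib_left mult.assoc)
        then have "\<theta> * (\<Sum>k<l. r ^ k * a k x) \<le> \<theta> * (r * (\<Sum>k<l. r ^ k * a (Suc k) x))"
          using \<theta> by (intro mult_left_mono) auto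
        also have "\<dots> = (\<Sum>k<l. r ^ k * a (Suc k) x)"
          using r by (simp flip: mult.assoc)
        finally show ?thesis using Z by (simp add: \<phi>_def divide_right_mono)
      qed
      then show "P1_op cem P X \<phi> x \<ge> ennreal (\<theta> * \<phi> x)"
        unfolding P1 by (rule ennreal_leI)
    qed
  qed
qed

end

section \<open>Assumption (E)\<close>

text \<open>
  The target is reached from \<open>x\<close> at a time \<open>k \<le> n\<^sub>0\<close> that depends on \<open>x\<close>. Being back at \<open>x\<^sub>0\<close> after
  the remaining time costs a factor that is positive as soon as \<open>n - n\<^sub>0 \<ge> N\<close>, and only the finitely
  many values of \<open>n - k\<close> with \<open>k \<le> n\<^sub>0\<close> occur.
\<close>

lemma minorization_by_atom:
  assumes visit: "\<forall>x\<in>K. \<exists>k\<le>n\<^sub>0. \<delta> \<le> pmf (kpow \<kappa> k x) x\<^sub>0" and \<delta>: "\<delta> > 0"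
    and aper: "\<forall>n\<ge>N. pmf (kpow \<kappa> n x\<^sub>0) x\<^sub>0 > 0"
  obtains n c where "n > 0" "c > 0" "\<forall>x\<in>K. c \<le> pmf (kpow \<kappa> n x) x\<^sub>0"
proof -
  define n where "n = n\<^sub>0 + N + 1"
  define m where "m = Min ((\<lambda>k. pmf (kpow \<kappa> (n - k) x\<^sub>0) x\<^sub>0) ` {..n\<^sub>0})"
  have m_le: "m \<le> pmf (kpow \<kappa> (n - k) x\<^sub>0) x\<^sub>0" if "k \<le> n\<^sub>0" for k
    unfolding m_def using that by (intro Min_le) auto
  have m: "m > 0" unfolding m_def using aper by (subst Min_gr_iff) (auto simp: n_def)
  show ?thesis
  proof (rule that[of n "\<delta> * m"])
    show "\<forall>x\<in>K. \<delta> * m \<le> pmf (kpow \<kappa> n x) x\<^sub>0"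
    proof
      fix x assume "x \<in> K"
      then obtain k where k: "k \<le> n\<^sub>0" "\<delta> \<le> pmf (kpow \<kappa> k x) x\<^sub>0" using visit by blast
      have "\<delta> * m \<le> pmf (kpow \<kappa> k x) x\<^sub>0 * pmf (kpow \<kappa> (n - k) x\<^sub>0) x\<^sub>0"
        using k m \<delta> m_le by (intro mult_mono) auto
      also have "\<dots> \<le> pmf (kpow \<kappa> (k + (n - k)) x) x\<^sub>0" by (rule pmf_kpow_add_ge)
      also have "k + (n - k) = n" using k by (simp add: n_def)
      finally show "\<delta> * m \<le> pmf (kpow \<kappa> n x) x\<^sub>0" .
    qed
  qed (use m \<delta> in \<open>auto simp: n_def\<close>)
qed

text \<open>
  The quotient in (E3): the reference value \<open>t\<close> cancels. Its positivity keeps the infimum away from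
  \<open>0\<close>, where the quotient would be infinite.
\<close>

lemma SUP_divide_INF_le:
  assumes "a > 0" "t > 0" "b \<ge> 0"
    and "\<And>y. y \<in> K \<Longrightarrow> f y \<le> ennreal (b * t)" "\<And>y. y \<in> K \<Longrightarrow> ennreal (a * t) \<le> f y"
  shows "(SUP y\<in>K. f y) / (INF y\<in>K. f y) \<le> ennreal (b / a)"
proof (rule divide_le_posI_ennreal)
  have INF_ge: "ennreal (a * t) \<le> (INF y\<in>K. f y)"
    using assms by (intro INF_greatest)
  have "0 < ennreal (a * t)" using assms by simp
  then show "0 < (INF y\<in>K. f y)" using INF_ge by (rule less_le_trans)
  have "(SUP y\<in>K. f y) \<le> ennreal (b * t)"
    using assms by (intro SUP_least)
  also have "\<dots> = ennreal (b / a) * ennreal (a * t)"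
    using assms by (simp flip: ennreal_mult)
  also have "\<dots> \<le> ennreal (b / a) * (INF y\<in>K. f y)"
    using INF_ge by (rule mult_left_mono) simp
  finally show "(SUP y\<in>K. f y) \<le> (INF y\<in>K. f y) * ennreal (b / a)"
    by (simp add: mult.commute)
qed

theorem proposition8p1:
  fixes E K :: "'s set" and cem x\<^sub>0 :: 's
    and M :: "'w measure" and P :: "'s \<Rightarrow> 'w measure" and X :: "nat \<Rightarrow> 'w \<Rightarrow> 's"
    and R :: real
  assumes "absorbed_markov_chain E cem M P X"
    and "irreducible_in E P X"
    and "aperiodic_in E P X"
    and "\<forall>x\<in>E. AE \<omega> in P x. absorption_time X cem \<omega> < \<infinity>"
    and "R \<ge> 1"
    and "\<forall>x\<in>E. \<forall>y\<in>E. (\<lambda>n. root n (\<P>(\<omega> in P x. X n \<omega> = y))) \<longlonglongrightarrow> 1 / R"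
    and "K \<subseteq> E" and "K \<noteq> {}" and "x\<^sub>0 \<in> K"
    and a: "\<exists>\<epsilon>\<^sub>0>0. \<exists>C\<^sub>1. \<forall>x\<in>K. \<forall>n.
              \<P>(\<omega> in P x. enat n < min (return_time X K \<omega>) (absorption_time X cem \<omega>))
                \<le> C\<^sub>1 * (R + \<epsilon>\<^sub>0) powi (- int n)"
    and b: "\<exists>C\<^sub>2. \<forall>x\<in>K. \<forall>n.
              \<P>(\<omega> in P x. enat n < absorption_time X cem \<omega>)
                \<le> C\<^sub>2 * \<P>(\<omega> in P x\<^sub>0. enat n < absorption_time X cem \<omega>)"
    and c: "\<exists>n\<^sub>0::nat. \<exists>C\<^sub>3>0. \<forall>x\<in>K.
              \<P>(\<omega> in P x. hitting_time X {x\<^sub>0} \<omega> \<le> enat n\<^sub>0) \<ge> C\<^sub>3"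
  shows "assumption_E E cem P X"
proof -
  interpret absorbed_markov_chain E cem M P X by fact
  have K_E: "x \<in> E" and K_states: "x \<in> states" if "x \<in> K" for x
    using that \<open>K \<subseteq> E\<close> by auto
  have x0: "x\<^sub>0 \<in> E" using K_E \<open>x\<^sub>0 \<in> K\<close> .
  let ?surv = "\<lambda>n y. \<P>(\<omega> in P y. enat n < absorption_time X cem \<omega>)"
  have prob_X_E: "\<P>(\<omega> in P x. X n \<omega> = y) = pmf (kpow step n x) y" if "x \<in> E" for x n y
    using that by (intro prob_X) simp

  obtain \<epsilon>\<^sub>0 C\<^sub>1 where "\<epsilon>\<^sub>0 > 0" and C1: "\<And>x n. x \<in> K \<Longrightarrow>
      \<P>(\<omega> in P x. enat n < min (return_time X K \<omega>) (absorption_time X cem \<omega>))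
        \<le> C\<^sub>1 * (R + \<epsilon>\<^sub>0) powi (- int n)"
    using a by blast
  obtain C\<^sub>2 where C2: "\<And>x n. x \<in> K \<Longrightarrow> ?surv n x \<le> C\<^sub>2 * ?surv n x\<^sub>0"
    using b by blast
  obtain n\<^sub>0 :: nat and C\<^sub>3 where "C\<^sub>3 > 0"
    and C3: "\<And>x. x \<in> K \<Longrightarrow> \<P>(\<omega> in P x. hitting_time X {x\<^sub>0} \<omega> \<le> enat n\<^sub>0) \<ge> C\<^sub>3"
    using c by blast
  \<comment> \<open>Hypothesis (c) in the form in which it is used for (E1), (E2) and (E3).\<close>
  define \<delta> where "\<delta> = C\<^sub>3 / (n\<^sub>0 + 1)"
  have \<delta>: "\<delta> > 0" using \<open>C\<^sub>3 > 0\<close> by (simp add: \<delta>_def)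
  have visit: "\<forall>x\<in>K. \<exists>k\<le>n\<^sub>0. \<delta> \<le> pmf (kpow step k x) x\<^sub>0"
    unfolding \<delta>_def using hitting_imp_visit[OF K_states C3] by blast
  obtain N where N: "\<forall>n\<ge>N. pmf (kpow step n x\<^sub>0) x\<^sub>0 > 0"
  proof -
    have "\<exists>N. \<forall>n\<ge>N. \<P>(\<omega> in P x\<^sub>0. X n \<omega> = x\<^sub>0) > 0"
      using \<open>aperiodic_in E P X\<close> x0 unfolding aperiodic_in_def by blast
    then show ?thesis using that by (auto simp: prob_X_E[OF x0])
  qed

  obtain n\<^sub>1 c\<^sub>1 where E1: "n\<^sub>1 > 0" "c\<^sub>1 > 0" "\<forall>x\<in>K. c\<^sub>1 \<le> pmf (kpow step n\<^sub>1 x) x\<^sub>0"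
    by (rule minorization_by_atom[OF visit \<delta> N])

  define s where "s = 1 / (R + \<epsilon>\<^sub>0)"
  have "s < 1 / R" "s > 0"
    using \<open>R \<ge> 1\<close> \<open>\<epsilon>\<^sub>0 > 0\<close> by (auto simp: s_def field_simps)
  then obtain \<theta>\<^sub>1 \<theta>\<^sub>2 where \<theta>: "s < \<theta>\<^sub>1" "\<theta>\<^sub>1 < \<theta>\<^sub>2" "\<theta>\<^sub>2 < 1 / R"
    using dense by meson
  have "1 / R \<le> 1" using \<open>R \<ge> 1\<close> by simp
  then have \<theta>': "0 < \<theta>\<^sub>1" "\<theta>\<^sub>1 < 1" "0 < \<theta>\<^sub>2" "\<theta>\<^sub>2 < 1" using \<theta> \<open>s > 0\<close> by auto

  have stay_le: "stay step (E - K) n x \<le> ennreal (C\<^sub>1 * s ^ n)" if "x \<in> K" for n x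
  proof -
    have "C\<^sub>1 * (R + \<epsilon>\<^sub>0) powi (- int n) = C\<^sub>1 * s ^ n"
      by (simp add: s_def power_int_minus power_one_over divide_inverse power_inverse)
    then show ?thesis
      using C1[OF that, of n] prob_survival_outside[OF K_E[OF that] \<open>K \<subseteq> E\<close>, of n]
      by (metis ennreal_leI)
  qed
  have "0 \<le> C\<^sub>1"
    using C1[OF \<open>x\<^sub>0 \<in> K\<close>, of 0] by (simp add: order_trans[OF measure_nonneg])
  \<comment> \<open>The geometric series bounding \<open>G\<close> on \<open>K\<close>; as only \<open>C\<^sub>1 \<ge> 0\<close> is at hand, \<open>1\<close> is added to get \<open>c\<^sub>2 > 0\<close>.\<close>
  define c\<^sub>2 where "c\<^sub>2 = C\<^sub>1 / (1 - 1 / \<theta>\<^sub>1 * s) + 1"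
  have "1 / \<theta>\<^sub>1 * s < 1" using \<theta> \<theta>' by simp
  then have "c\<^sub>2 > 0" using \<open>0 \<le> C\<^sub>1\<close> by (simp add: c\<^sub>2_def add_nonneg_pos)
  have gen_le: "\<forall>x\<in>K. stay_gen step (E - K) (1 / \<theta>\<^sub>1) x \<le> ennreal c\<^sub>2"
  proof
    fix x assume "x \<in> K"
    then have "stay_gen step (E - K) (1 / \<theta>\<^sub>1) x \<le> ennreal (C\<^sub>1 / (1 - 1 / \<theta>\<^sub>1 * s))"
      using \<open>0 \<le> C\<^sub>1\<close> \<open>s > 0\<close> \<theta>' \<open>1 / \<theta>\<^sub>1 * s < 1\<close>
      by (intro stay_gen_le_geometric stay_le) auto
    also have "\<dots> \<le> ennreal c\<^sub>2" unfolding c\<^sub>2_def by (rule ennreal_leI) simp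
    finally show "stay_gen step (E - K) (1 / \<theta>\<^sub>1) x \<le> ennreal c\<^sub>2" .
  qed
  have gen_K: "\<forall>x\<in>K. stay_gen step (E - K) (1 / \<theta>\<^sub>1) x < \<infinity>"
    using gen_le by (auto intro: le_less_trans)
  have gen_E: "\<forall>x\<in>E. stay_gen step (E - K) (1 / \<theta>\<^sub>1) x < \<infinity>"
  proof
    fix x assume "x \<in> E"
    then obtain n where "pmf (kpow step n x\<^sub>0) x > 0"
      using \<open>irreducible_in E P X\<close> x0 unfolding irreducible_in_def by (auto simp: prob_X_E)
    then have reach: "x \<in> set_pmf (kpow step n x\<^sub>0)" by (simp add: pmf_positive_iff)
    have "1 / \<theta>\<^sub>1 > 0" using \<theta>' by simp
    moreover have "stay_gen step (E - K) (1 / \<theta>\<^sub>1) x\<^sub>0 < \<infinity>" using gen_K \<open>x\<^sub>0 \<in> K\<close> by blast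
    ultimately show "stay_gen step (E - K) (1 / \<theta>\<^sub>1) x < \<infinity>"
      by (rule stay_gen_finite_reachable[OF gen_K _ x0 _ \<open>x \<in> E\<close> reach])
  qed
  obtain \<phi>\<^sub>1 :: "'s \<Rightarrow> real" where \<phi>1: "\<forall>x\<in>E. \<phi>\<^sub>1 x \<ge> 1" "\<forall>x\<in>K. \<phi>\<^sub>1 x = 1"
    "\<forall>x\<in>E. P1_op cem P X \<phi>\<^sub>1 x \<le> ennreal (\<theta>\<^sub>1 * \<phi>\<^sub>1 x + c\<^sub>2 * indicator K x)"
    by (rule upper_drift_function[OF \<open>K \<subseteq> E\<close> \<theta>'(1,2) gen_le gen_E])

  \<comment> \<open>The bound \<open>l > n\<^sub>0\<close> puts every visiting time \<open>k \<le> n\<^sub>0\<close> into the sum that defines \<open>\<phi>\<^sub>2\<close>.\<close>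
  obtain l where l: "l > n\<^sub>0" "\<theta>\<^sub>2 ^ l \<le> pmf (kpow step l x\<^sub>0) x\<^sub>0"
  proof -
    have "(\<lambda>n. root n (pmf (kpow step n x\<^sub>0) x\<^sub>0)) \<longlonglongrightarrow> 1 / R"
      using assms(6) x0 by (simp add: prob_X_E)
    then have "\<forall>\<^sub>F n in sequentially. \<theta>\<^sub>2 < root n (pmf (kpow step n x\<^sub>0) x\<^sub>0)"
      using \<theta>(3) by (rule order_tendstoD)
    then obtain L where L: "\<And>n. n \<ge> L \<Longrightarrow> \<theta>\<^sub>2 < root n (pmf (kpow step n x\<^sub>0) x\<^sub>0)"
      by (auto simp: eventually_sequentially)
    define l where "l = max L (Suc n\<^sub>0)"
    have "l > n\<^sub>0" and less: "\<theta>\<^sub>2 < root l (pmf (kpow step l x\<^sub>0) x\<^sub>0)"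
      using L[of l] by (auto simp: l_def)
    have "\<theta>\<^sub>2 ^ l \<le> root l (pmf (kpow step l x\<^sub>0) x\<^sub>0) ^ l"
      using less \<theta>' by (intro power_mono) auto
    also have "\<dots> = pmf (kpow step l x\<^sub>0) x\<^sub>0"
      using \<open>l > n\<^sub>0\<close> by (intro real_root_pow_pos2) auto
    finally show ?thesis using that \<open>l > n\<^sub>0\<close> by blast
  qed
  obtain \<phi>\<^sub>2 :: "'s \<Rightarrow> real" and c where \<phi>2: "\<forall>x\<in>E. 0 \<le> \<phi>\<^sub>2 x \<and> \<phi>\<^sub>2 x \<le> 1" "c > 0"
    "\<forall>x\<in>E. \<forall>k<l. c * pmf (kpow step k x) x\<^sub>0 \<le> \<phi>\<^sub>2 x"
    "\<forall>x\<in>E. P1_op cem P X \<phi>\<^sub>2 x \<ge> ennreal (\<theta>\<^sub>2 * \<phi>\<^sub>2 x)"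
    by (rule lower_drift_function[OF x0 \<theta>'(3,4) _ l(2)]) (use l(1) in simp)
  have \<phi>2_ge: "c * \<delta> \<le> \<phi>\<^sub>2 x" if x: "x \<in> K" for x
  proof -
    obtain k where k: "k \<le> n\<^sub>0" "\<delta> \<le> pmf (kpow step k x) x\<^sub>0" using visit x by blast
    then have "c * \<delta> \<le> c * pmf (kpow step k x) x\<^sub>0" using \<phi>2(2) by simp
    also have "\<dots> \<le> \<phi>\<^sub>2 x" using \<phi>2(3) K_E[OF x] k l(1) by simp
    finally show ?thesis .
  qed

  have surv_pos: "?surv n x\<^sub>0 > 0" for n
    using survival_pos[OF x0 N, of n] unfolding prob_survival[OF x0, symmetric] by simp
  have surv_ge: "\<delta> * ?surv n x\<^sub>0 \<le> ?surv n x" if x: "x \<in> K" for n x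
  proof -
    obtain k where "\<delta> \<le> pmf (kpow step k x) x\<^sub>0" using visit x by blast
    from survival_ge_if_visit[OF x0 K_states[OF x] this, of n] show ?thesis
      unfolding prob_survival[OF x0, symmetric] prob_survival[OF K_E[OF x], symmetric]
      using \<delta> by (simp add: ennreal_mult[symmetric])
  qed
  have "C\<^sub>2 \<ge> 1" using C2[OF \<open>x\<^sub>0 \<in> K\<close>, of 0] surv_pos[of 0] by simp
  have E3: "(SUP n. (SUP y\<in>K. ennreal (?surv n y)) / (INF y\<in>K. ennreal (?surv n y)))
      \<le> ennreal (C\<^sub>2 / \<delta>)"
  proof (rule SUP_least)
    fix n
    show "(SUP y\<in>K. ennreal (?surv n y)) / (INF y\<in>K. ennreal (?surv n y)) \<le> ennreal (C\<^sub>2 / \<delta>)"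
    proof (rule SUP_divide_INF_le[OF \<delta> surv_pos])
      show "C\<^sub>2 \<ge> 0" using \<open>C\<^sub>2 \<ge> 1\<close> by simp
    qed (use C2 surv_ge in \<open>auto intro: ennreal_leI\<close>)
  qed

  let ?\<nu> = "return (count_space K) x\<^sub>0"
  have \<nu>: "prob_space ?\<nu>" using \<open>x\<^sub>0 \<in> K\<close> by (intro prob_space_return) simp
  have E1': "\<P>(\<omega> in P x. X n\<^sub>1 \<omega> \<in> A) \<ge> c\<^sub>1 * measure ?\<nu> (A \<inter> K)" if x: "x \<in> K" for x A
  proof (cases "x\<^sub>0 \<in> A")
    case True
    interpret prob_space "P x" by (rule prob_space_P[OF K_states[OF x]])
    have "c\<^sub>1 * measure ?\<nu> (A \<inter> K) \<le> c\<^sub>1"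
      using E1(2) prob_space.prob_le_1[OF \<nu>] by (simp add: mult_left_le)
    also have "\<dots> \<le> \<P>(\<omega> in P x. X n\<^sub>1 \<omega> = x\<^sub>0)"
      using E1(3) x by (simp add: prob_X_E[OF K_E])
    also have "\<dots> \<le> \<P>(\<omega> in P x. X n\<^sub>1 \<omega> \<in> A)"
      using True sets_all_X[OF K_states[OF x], of "{n\<^sub>1}" "\<lambda>_. A"]
      by (intro finite_measure_mono) auto
    finally show ?thesis .
  next
    case False
    then show ?thesis by (simp add: measure_return)
  qed
  have E4: "\<exists>n\<^sub>4. \<forall>n\<ge>n\<^sub>4. \<P>(\<omega> in P x. X n \<omega> \<in> K) > 0" if x: "x \<in> K" for x
  proof -
    interpret prob_space "P x" by (rule prob_space_P[OF K_states[OF x]])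
    obtain N where N: "\<forall>n\<ge>N. \<P>(\<omega> in P x. X n \<omega> = x\<^sub>0) > 0"
      using \<open>aperiodic_in E P X\<close> x0 K_E[OF x] unfolding aperiodic_in_def by blast
    have "\<P>(\<omega> in P x. X n \<omega> = x\<^sub>0) \<le> \<P>(\<omega> in P x. X n \<omega> \<in> K)" for n
      using \<open>x\<^sub>0 \<in> K\<close> sets_all_X[OF K_states[OF x], of "{n}" "\<lambda>_. K"]
      by (intro finite_measure_mono) auto
    then show ?thesis using N by (meson less_le_trans)
  qed
  have "(SUP x\<in>K. ereal (\<phi>\<^sub>1 x)) \<le> 1" using \<phi>1(2) by (intro SUP_least) simp
  then have sup_\<phi>1: "(SUP x\<in>K. ereal (\<phi>\<^sub>1 x)) < \<infinity>" by (rule le_less_trans) simp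
  have "ereal 0 < ereal (c * \<delta>)" using \<phi>2(2) \<delta> by simp
  also have "\<dots> \<le> (INF x\<in>K. ereal (\<phi>\<^sub>2 x))" using \<phi>2_ge by (intro INF_greatest) simp
  finally have inf_\<phi>2: "(INF x\<in>K. ereal (\<phi>\<^sub>2 x)) > 0" by (simp add: zero_ereal_def)
  have inf_\<phi>1: "(INF x\<in>E. ereal (\<phi>\<^sub>1 x)) \<ge> 1" using \<phi>1(1) by (intro INF_greatest) simp
  have sup_\<phi>2: "(SUP x\<in>E. ereal (\<phi>\<^sub>2 x)) \<le> 1" using \<phi>2(1) by (intro SUP_least) simp
  have c3: "C\<^sub>2 / \<delta> > 0" using \<open>C\<^sub>2 \<ge> 1\<close> \<delta> by simp
  show ?thesis
    unfolding assumption_E_def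
  proof (rule exI[of _ n\<^sub>1], rule exI[of _ \<theta>\<^sub>1], rule exI[of _ \<theta>\<^sub>2], rule exI[of _ c\<^sub>1],
      rule exI[of _ c\<^sub>2], rule exI[of _ "C\<^sub>2 / \<delta>"], rule exI[of _ \<phi>\<^sub>1], rule exI[of _ \<phi>\<^sub>2],
      rule exI[of _ K], rule exI[of _ ?\<nu>], intro conjI)
    show "n\<^sub>1 > 0" "\<theta>\<^sub>1 > 0" "\<theta>\<^sub>2 > 0" "c\<^sub>1 > 0" "c\<^sub>2 > 0" "C\<^sub>2 / \<delta> > 0" "\<theta>\<^sub>1 < \<theta>\<^sub>2" by fact+
    show "\<forall>x\<in>E. \<phi>\<^sub>1 x \<ge> 0" using \<phi>1(1) by (auto intro: order_trans[OF zero_le_one])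
    show "\<forall>x\<in>E. \<phi>\<^sub>2 x \<ge> 0" using \<phi>2(1) by blast
    show "K \<subseteq> E" "prob_space ?\<nu>" by fact+
    show "sets ?\<nu> = sets (count_space K)" by simp
    show "\<forall>x\<in>K. \<forall>A\<subseteq>E. \<P>(\<omega> in P x. X n\<^sub>1 \<omega> \<in> A) \<ge> c\<^sub>1 * measure ?\<nu> (A \<inter> K)"
      using E1' by blast
    show "\<forall>x\<in>K. \<exists>n\<^sub>4. \<forall>n\<ge>n\<^sub>4. \<P>(\<omega> in P x. X n \<omega> \<in> K) > 0" using E4 by blast
  qed (fact inf_\<phi>1 sup_\<phi>1 inf_\<phi>2 sup_\<phi>2 \<phi>1(3) \<phi>2(4) E3)+
qed

end
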